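(* Let $G=(V,E)$ be a finite, connected, simple graph. For any $\kappa_0>0$ and $\alpha\in[0,1)$, \[ {\rm Diam}(G)\le \left\lfloor \frac{2+\dfrac{I^\alpha_{\kappa_0}}{1-\alpha}}{\kappa_0}\right\rfloor \qquad\text{and}\qquad {\rm Diam}(G)\le \left\lfloor \frac{2+I_{\kappa_0}}{\kappa_0}\right\rfloor . \]
   Context: $G=(V,E)$ is a finite, connected, simple (unweighted, undirected, no loops or multiple edges) graph; $d(x,y)$ is the graph (shortest-path) distance and ${\rm Diam}(G)=\max_{x,y\in V}d(x,y)$. For $x\in V$, $\Gamma(x)=\{v: vx\in E\}$ and $d_x=|\Gamma(x)|$. For probability measures $m_1,m_2$ on $V$, the transportation distance is $W(m_1,m_2)=\inf_A\sum_{x,y\in V}A(x,y)d(x,y)$, the infimum over couplings $A:V\times V\to[0,1]$ with $\sum_y A(x,y)=m_1(x)$ and $\sum_x A(x,y)=m_2(y)$. For $\alpha\in[0,1)$ the $\alpha$-lazy random walk measure is $m^\alpha_x(v)=\alpha$ if $v=x$, $(1-\alpha)/d_x$ if $v\in\Gamma(x)$, and $0$ otherwise. The $\alpha$-Ricci curvature is $\kappa_\alpha(x,y)=1-W(m^\alpha_x,m^\alpha_y)/d(x,y)$ for $x\ne y$, and the Lin–Lu–Yau Ricci curvature is $\kappa_{LLY}(x,y)=\lim_{\alpha\to1^-}\kappa_\alpha(x,y)/(1-\alpha)$ (this limit exists). For $\kappa_0\in\mathbb{R}$, set $\rho^\alpha_{\kappa_0}(x,y)=\max\{0,(1-\alpha)\kappa_0-\kappa_\alpha(x,y)\}$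 and $\rho_{\kappa_0}(x,y)=\max\{0,\kappa_0-\kappa_{LLY}(x,y)\}$, and define the integral curvatures $I^\alpha_{\kappa_0}=\sum_{xy\in E}\rho^\alpha_{\kappa_0}(x,y)$ and $I_{\kappa_0}=\sum_{xy\in E}\rho_{\kappa_0}(x,y)$, the sums being over the edges of $G$ (each edge counted once). *)

theory Defs
  imports Complex_Main "Graph_Theory.Graph_Theory"
begin

text \<open>
  A finite simple graph is a \<^locale>\<open>pair_graph\<close>: a finite symmetric loop-free digraph whose
  arcs are ordered pairs of vertices. An undirected edge \<open>xy\<close> is thus represented by the two
  arcs \<open>(x, y)\<close> and \<open>(y, x)\<close>.
\<close>

definition graph_dist :: "'a pair_pre_digraph \<Rightarrow> 'a \<Rightarrow> 'a \<Rightarrow> real" where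
  "graph_dist G x y = real_of_ereal (wf_digraph.\<mu> (with_proj G) (\<lambda>_. 1) x y)"

definition graph_diam :: "'a pair_pre_digraph \<Rightarrow> real" where
  "graph_diam G = Max {graph_dist G x y | x y. x \<in> pverts G \<and> y \<in> pverts G}"

definition nbhd :: "'a pair_pre_digraph \<Rightarrow> 'a \<Rightarrow> 'a set" where
  "nbhd G x = {v. (v, x) \<in> parcs G}"

definition couplings ::
  "'a pair_pre_digraph \<Rightarrow> ('a \<Rightarrow> real) \<Rightarrow> ('a \<Rightarrow> real) \<Rightarrow> ('a \<Rightarrow> 'a \<Rightarrow> real) set" where
  "couplings G m1 m2 = {A.
     (\<forall>x\<in>pverts G. \<forall>y\<in>pverts G. 0 \<le> A x y \<and> A x y \<le> 1) \<and>
     (\<forall>x\<in>pverts G. (\<Sum>y\<in>pverts G. A x y) = m1 x) \<and>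
     (\<forall>y\<in>pverts G. (\<Sum>x\<in>pverts G. A x y) = m2 y)}"

definition transport_dist ::
  "'a pair_pre_digraph \<Rightarrow> ('a \<Rightarrow> real) \<Rightarrow> ('a \<Rightarrow> real) \<Rightarrow> real" where
  "transport_dist G m1 m2 =
     (INF A\<in>couplings G m1 m2. \<Sum>x\<in>pverts G. \<Sum>y\<in>pverts G. A x y * graph_dist G x y)"

definition lazy_walk :: "'a pair_pre_digraph \<Rightarrow> real \<Rightarrow> 'a \<Rightarrow> 'a \<Rightarrow> real" where
  "lazy_walk G \<alpha> x v =
     (if v = x then \<alpha>
      else if v \<in> nbhd G x then (1 - \<alpha>) / real (card (nbhd G x))
      else 0)"

text \<open>The two curvatures below are meaningful for \<open>x \<noteq> y\<close> only.\<close>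

definition ricci :: "'a pair_pre_digraph \<Rightarrow> real \<Rightarrow> 'a \<Rightarrow> 'a \<Rightarrow> real" where
  "ricci G \<alpha> x y =
     1 - transport_dist G (lazy_walk G \<alpha> x) (lazy_walk G \<alpha> y) / graph_dist G x y"

definition ricci_LLY :: "'a pair_pre_digraph \<Rightarrow> 'a \<Rightarrow> 'a \<Rightarrow> real" where
  "ricci_LLY G x y = Lim (at_left 1) (\<lambda>\<alpha>. ricci G \<alpha> x y / (1 - \<alpha>))"

definition rho_lazy :: "'a pair_pre_digraph \<Rightarrow> real \<Rightarrow> real \<Rightarrow> 'a \<Rightarrow> 'a \<Rightarrow> real" where
  "rho_lazy G \<alpha> \<kappa>0 x y = max 0 ((1 - \<alpha>) * \<kappa>0 - ricci G \<alpha> x y)"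

definition rho_LLY :: "'a pair_pre_digraph \<Rightarrow> real \<Rightarrow> 'a \<Rightarrow> 'a \<Rightarrow> real" where
  "rho_LLY G \<kappa>0 x y = max 0 (\<kappa>0 - ricci_LLY G x y)"

text \<open>
  Sum of a symmetric function over the undirected edges, each counted once. Every edge gives two
  arcs, whence the division by 2; \<open>edge_sum_orientation\<close> below shows that the value is the sum
  over any choice of one arc per edge.
\<close>

definition edge_sum :: "'a pair_pre_digraph \<Rightarrow> ('a \<Rightarrow> 'a \<Rightarrow> real) \<Rightarrow> real" where
  "edge_sum G f = (\<Sum>(x, y)\<in>parcs G. f x y) / 2"

definition integral_curv_lazy :: "'a pair_pre_digraph \<Rightarrow> real \<Rightarrow> real \<Rightarrow> real" where
  "integral_curv_lazy G \<alpha> \<kappa>0 = edge_sum G (rho_lazy G \<alpha> \<kappa>0)"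

definition integral_curv_LLY :: "'a pair_pre_digraph \<Rightarrow> real \<Rightarrow> real" where
  "integral_curv_LLY G \<kappa>0 = edge_sum G (rho_LLY G \<kappa>0)"

lemma edge_sum_orientation:
  assumes "pair_graph G"
    and sym: "\<And>x y. f x y = f y x"
    and D: "parcs G = D \<union> D\<inverse>" "D \<inter> D\<inverse> = {}"
  shows "edge_sum G f = (\<Sum>(x, y)\<in>D. f x y)"
proof -
  interpret pair_graph G by fact
  have fin: "finite D" "finite (D\<inverse>)"
    using pair_finite_arcs D(1) by (metis finite_Un)+
  have "(\<Sum>(x, y)\<in>D\<inverse>. f x y) = (\<Sum>(x, y)\<in>D. f y x)"
    by (rule sum.reindex_bij_witness[of _ prod.swap prod.swap]) auto
  also have "\<dots> = (\<Sum>(x, y)\<in>D. f x y)"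
    by (subst sym) (rule refl)
  finally show ?thesis
    unfolding edge_sum_def D(1) using fin D(2) by (simp add: sum.union_disjoint)
qed

lemma graph_dist_commute:
  assumes "pair_graph G"
  shows "graph_dist G x y = graph_dist G y x"
proof -
  interpret pair_graph G by fact
  have rev: "awalk v (rev (map prod.swap p)) u" if "awalk u p v" for u p v
    using that
  proof (induction p arbitrary: u)
    case Nil
    then show ?case by (auto simp: awalk_Nil_iff)
  next
    case (Cons e p)
    then have e: "e \<in> parcs G" "fst e = u" "awalk (snd e) p v"
      by (auto simp: awalk_Cons_iff)
    have "(snd e, fst e) \<in> parcs G"
      using pair_sym_arcs e(1) by (cases e) (auto simp: symmetric_def dest: symD)
    then have "awalk (snd e) [(snd e, fst e)] (fst e)"
      using e(1) by (auto simp: awalk_Cons_iff awalk_Nil_iff intro: wellformed')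
    with Cons.IH[OF e(3)] e(2) show ?case
      by (cases e) (auto intro: awalk_appendI)
  qed
  have cost: "awalk_cost (\<lambda>_. 1) p = real (length p)" for p :: "('a \<times> 'a) list"
    by (induction p) auto
  have le: "\<mu> (\<lambda>_. 1) u v \<le> \<mu> (\<lambda>_. 1) v u" for u v
    unfolding \<mu>_def
  proof (rule INF_mono)
    fix p assume "p \<in> {p. awalk v p u}"
    then show "\<exists>q\<in>{p. awalk u p v}.
        ereal (awalk_cost (\<lambda>_. 1) q) \<le> ereal (awalk_cost (\<lambda>_. 1) p)"
      using rev[of v p u] by (intro bexI[of _ "rev (map prod.swap p)"]) (auto simp: cost)
  qed
  show ?thesis
    unfolding graph_dist_def using le[of x y] le[of y x] by simp
qed

lemma transport_dist_commute:
  assumes "pair_graph G"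
  shows "transport_dist G m1 m2 = transport_dist G m2 m1"
proof -
  let ?cost = "\<lambda>A. \<Sum>x\<in>pverts G. \<Sum>y\<in>pverts G. A x y * graph_dist G x y"
  have flip: "couplings G m2 m1 = (\<lambda>A x y. A y x) ` couplings G m1 m2"
  proof (intro equalityI subsetI)
    fix A assume "A \<in> couplings G m2 m1"
    then have "(\<lambda>x y. A y x) \<in> couplings G m1 m2" by (auto simp: couplings_def)
    then show "A \<in> (\<lambda>A x y. A y x) ` couplings G m1 m2" by (rule rev_image_eqI) simp
  qed (auto simp: couplings_def)
  have "?cost (\<lambda>x y. A y x) = ?cost A" for A
    by (subst sum.swap) (metis (no_types, lifting) graph_dist_commute[OF assms] sum.cong)
  then have "?cost ` couplings G m2 m1 = ?cost ` couplings G m1 m2"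
    unfolding flip image_image by (rule image_cong[OF refl])
  then show ?thesis
    by (simp add: transport_dist_def)
qed

lemma rho_commute:
  assumes "pair_graph G"
  shows "rho_lazy G \<alpha> \<kappa>0 x y = rho_lazy G \<alpha> \<kappa>0 y x"
    and "rho_LLY G \<kappa>0 x y = rho_LLY G \<kappa>0 y x"
proof -
  have "ricci G a x y = ricci G a y x" for a
    unfolding ricci_def using graph_dist_commute[OF assms] transport_dist_commute[OF assms]
    by metis
  then show "rho_lazy G \<alpha> \<kappa>0 x y = rho_lazy G \<alpha> \<kappa>0 y x"
    and "rho_LLY G \<kappa>0 x y = rho_LLY G \<kappa>0 y x"
    by (simp_all add: rho_lazy_def rho_LLY_def ricci_LLY_def)
qed

end

theory Submission
  imports Defs "HOL-Analysis.Elementary_Topology"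
begin

text \<open>
  Along a geodesic \<open>x\<^sub>0, \<dots>, x\<^sub>n\<close> the function \<open>f v = d(x\<^sub>0, v)\<close> is 1-Lipschitz, so the easy half of
  Kantorovich duality bounds the increment of its mean from the walk at \<open>x\<^sub>i\<close> to the walk at
  \<open>x\<^sub>i\<^sub>+\<^sub>1\<close> by the transportation distance \<open>1 - \<kappa>\<^sub>\<alpha>(x\<^sub>i, x\<^sub>i\<^sub>+\<^sub>1)\<close>. These increments
  telescope to at least \<open>n - 2 (1 - \<alpha>)\<close>; hence the curvatures \<open>\<kappa>\<^sub>\<alpha>\<close> along the geodesic add up to at
  most \<open>2 (1 - \<alpha>)\<close>, while the integral curvature forces their sum to be at least
  \<open>n (1 - \<alpha>) \<kappa>\<^sub>0 - I\<close>. For the Lin--Lu--Yau curvature one lets \<open>\<alpha> \<rightarrow> 1\<close>, the limits existing because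
  \<open>\<kappa>\<^sub>\<alpha> / (1 - \<alpha>)\<close> is bounded and increasing in \<open>\<alpha>\<close>.
\<close>

section \<open>Graph distance and geodesics\<close>

lemma (in wf_digraph) awalk_cost_one: "awalk_cost (\<lambda>_. 1) p = real (length p)"
  by (induction p) auto

locale pair_connected_graph = pair_graph +
  assumes connected: "Digraph_Component.connected (with_proj G)"
begin

lemma pverts_nonempty: "pverts G \<noteq> {}"
  using connected by (auto simp: connected_def strongly_connected_def)

text \<open>\<open>real_of_ereal\<close> sends infinite values to 0, so inequalities in
  \<open>ereal\<close> transfer to \<open>graph_dist\<close> only for finite infima; reachability
  makes the infimum attained.\<close>

lemma graph_dist_le_length:
  assumes "awalk u p v"
  shows "graph_dist G u v \<le> real (length p)"
proof -
  have "u \<rightarrow>\<^sup>*\<^bsub>with_proj G\<^esub> v"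
    using assms by (rule reachable_awalkI)
  then obtain q where "\<mu> (\<lambda>_. 1) u v = ereal (awalk_cost (\<lambda>_. 1) q)"
    using min_cost_awalk[of u v "\<lambda>_. 1"] by auto
  with min_cost_le_walk_cost[OF assms, of "\<lambda>_. 1"] show ?thesis
    by (simp add: graph_dist_def awalk_cost_one)
qed

lemma graph_dist_awalk:
  assumes "u \<in> pverts G" "v \<in> pverts G"
  obtains p where "awalk u p v" "graph_dist G u v = real (length p)"
proof -
  have "strongly_connected (with_proj G)"
    using symmetric_connected_imp_strongly_connected[OF sym_arcs connected] .
  then have "u \<rightarrow>\<^sup>*\<^bsub>with_proj G\<^esub> v"
    using assms by auto
  then obtain q where "apath u q v" "\<mu> (\<lambda>_. 1) u v = ereal (awalk_cost (\<lambda>_. 1) q)"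
    using min_cost_awalk[of u v "\<lambda>_. 1"] by auto
  then show ?thesis
    using that[of q] by (simp add: graph_dist_def awalk_cost_one awalkI_apath)
qed

lemma graph_dist_nonneg:
  assumes "u \<in> pverts G" "v \<in> pverts G"
  shows "0 \<le> graph_dist G u v"
  using assms by (metis graph_dist_awalk of_nat_0_le_iff)

lemma graph_dist_self:
  assumes "u \<in> pverts G"
  shows "graph_dist G u u = 0"
  using graph_dist_le_length[of u "[]" u] graph_dist_nonneg[of u u] assms
  by (simp add: awalk_Nil_iff)

lemma graph_dist_eq_0D:
  assumes "u \<in> pverts G" "v \<in> pverts G" "graph_dist G u v = 0"
  shows "u = v"
proof -
  obtain p where "awalk u p v" "graph_dist G u v = real (length p)"
    using assms by (auto elim: graph_dist_awalk)
  with assms(3) show ?thesis by (simp add: awalk_Nil_iff)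
qed

lemma graph_dist_triangle:
  assumes "u \<in> pverts G" "v \<in> pverts G" "w \<in> pverts G"
  shows "graph_dist G u w \<le> graph_dist G u v + graph_dist G v w"
proof -
  obtain p where p: "awalk u p v" "graph_dist G u v = real (length p)"
    using assms by (auto elim: graph_dist_awalk)
  obtain q where q: "awalk v q w" "graph_dist G v w = real (length q)"
    using assms by (auto elim: graph_dist_awalk)
  show ?thesis
    using graph_dist_le_length[OF awalk_appendI[OF p(1) q(1)]] p(2) q(2) by simp
qed

lemma graph_dist_arc:
  assumes "(u, v) \<in> parcs G"
  shows "graph_dist G u v = 1"
proof -
  have uv: "u \<in> pverts G" "v \<in> pverts G" "u \<noteq> v"
    using assms wellformed' no_loops' by auto
  then have "graph_dist G u v \<le> 1"
    using graph_dist_le_length[of u "[(u, v)]" v] assms by (simp add: awalk_simps)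
  moreover obtain p where "awalk u p v" "graph_dist G u v = real (length p)"
    using uv by (auto elim: graph_dist_awalk)
  moreover have "graph_dist G u v \<noteq> 0"
    using graph_dist_eq_0D uv by blast
  ultimately show ?thesis
    by (cases "length p") auto
qed

text \<open>A shortest walk without its last arc is still shortest, by the triangle inequality. The
  distances from \<open>u\<close> are recorded because they make the vertices distinct.\<close>

lemma geodesic:
  assumes "u \<in> pverts G" "v \<in> pverts G" "graph_dist G u v = real n"
  shows "\<exists>x. x 0 = u \<and> x n = v \<and> (\<forall>i<n. (x i, x (Suc i)) \<in> parcs G)
    \<and> (\<forall>i\<le>n. graph_dist G u (x i) = real i)"
  using assms(2,3)
proof (induction n arbitrary: v)
  case 0
  then have "u = v"
    using assms(1) graph_dist_eq_0D by simp
  with 0 show ?case by (intro exI[of _ "\<lambda>_. u"]) auto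
next
  case (Suc n)
  obtain p where p: "awalk u p v" "graph_dist G u v = real (length p)"
    using assms(1) Suc.prems by (auto elim: graph_dist_awalk)
  with Suc.prems have "p \<noteq> []" by auto
  then obtain q e where pq: "p = q @ [e]"
    by (metis append_butlast_last_id)
  define w where "w = fst e"
  have qe: "awalk u q w" "(w, v) \<in> parcs G" "length q = n"
    using p Suc.prems(2) by (auto simp: pq w_def awalk_simps)
  have w: "w \<in> pverts G"
    using qe(2) wellformed' by auto
  have "graph_dist G u v \<le> graph_dist G u w + 1"
    using graph_dist_triangle[OF assms(1) w Suc.prems(1)] graph_dist_arc[OF qe(2)] by simp
  with graph_dist_le_length[OF qe(1)] qe(3) Suc.prems(2) have "graph_dist G u w = real n"
    by simp
  from Suc.IH[OF w this] obtain x where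
    x: "x 0 = u" "x n = w" "\<And>i. i < n \<Longrightarrow> (x i, x (Suc i)) \<in> parcs G"
      "\<And>i. i \<le> n \<Longrightarrow> graph_dist G u (x i) = real i"
    by blast
  show ?case
    using x qe(2) Suc.prems(2)
    by (intro exI[of _ "x(Suc n := v)"]) (auto simp: less_Suc_eq le_Suc_eq)
qed

text \<open>\<open>edge_sum\<close> is half a sum over arcs, so each edge of the path is taken in
  both directions: injectivity makes the \<open>n\<close> arcs and their reverses
  \<open>2 * n\<close> different arcs, and the remaining arcs contribute nonnegative terms.\<close>

lemma geodesic_sum_le_edge_sum:
  assumes arcs: "\<And>i. i < n \<Longrightarrow> (x i, x (Suc i)) \<in> parcs G"
    and inj: "inj_on x {..n}"
    and sym: "\<And>u v. f u v = f v u"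
    and nonneg: "\<And>u v. 0 \<le> f u v"
  shows "(\<Sum>i<n. f (x i) (x (Suc i))) \<le> edge_sum G f"
proof -
  let ?g = "\<lambda>(u, v). f u v"
  let ?D = "(\<lambda>i. (x i, x (Suc i))) ` {..<n}" and ?E = "(\<lambda>i. (x (Suc i), x i)) ` {..<n}"
  have eq: "x i = x j \<longleftrightarrow> i = j" if "i \<le> n" "j \<le> n" for i j
    using inj that by (auto dest: inj_onD)
  have "inj_on (\<lambda>i. (x i, x (Suc i))) {..<n}" "inj_on (\<lambda>i. (x (Suc i), x i)) {..<n}"
    by (auto simp: inj_on_def eq)
  then have D: "sum ?g ?D = (\<Sum>i<n. f (x i) (x (Suc i)))"
    and E: "sum ?g ?E = (\<Sum>i<n. f (x i) (x (Suc i)))"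
    using sym by (simp_all add: sum.reindex)
  \<comment> \<open>A forward arc equal to a reversed one would need both \<open>i = Suc j\<close>
    and \<open>Suc i = j\<close>.\<close>
  have "?D \<inter> ?E = {}"
    by (auto simp: eq)
  then have "2 * (\<Sum>i<n. f (x i) (x (Suc i))) = sum ?g (?D \<union> ?E)"
    using D E by (simp add: sum.union_disjoint)
  also have "\<dots> \<le> sum ?g (parcs G)"
    using arcs arcs_symmetric nonneg by (intro sum_mono2 finite_arcs) auto
  finally show ?thesis
    by (simp add: edge_sum_def)
qed

section \<open>Means under the lazy random walk\<close>

definition lazy_mean :: "real \<Rightarrow> 'a \<Rightarrow> ('a \<Rightarrow> real) \<Rightarrow> real" where
  "lazy_mean \<alpha> x f = (\<Sum>v\<in>pverts G. lazy_walk G \<alpha> x v * f v)"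

lemma nbhd_subset: "nbhd G x \<subseteq> pverts G - {x}"
  using wellformed' no_loops'[of x x] by (auto simp: nbhd_def)

lemma finite_nbhd: "finite (nbhd G x)"
  using nbhd_subset finite_verts by (meson finite_Diff finite_subset)

lemma lazy_mean_eq:
  assumes "x \<in> pverts G"
  shows "lazy_mean \<alpha> x f = \<alpha> * f x + (1 - \<alpha>) / real (card (nbhd G x)) * (\<Sum>v\<in>nbhd G x. f v)"
proof -
  have "lazy_mean \<alpha> x f
    = \<alpha> * f x + (\<Sum>v\<in>pverts G - {x}. lazy_walk G \<alpha> x v * f v)"
    unfolding lazy_mean_def using assms
    by (subst sum.remove[of _ x]) (auto simp: lazy_walk_def)
  also have "(\<Sum>v\<in>pverts G - {x}. lazy_walk G \<alpha> x v * f v)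
    = (\<Sum>v\<in>nbhd G x. (1 - \<alpha>) / real (card (nbhd G x)) * f v)"
    using nbhd_subset[of x] by (intro sum.mono_neutral_cong_right) (auto simp: lazy_walk_def)
  finally show ?thesis
    by (simp only: sum_distrib_left)
qed

text \<open>At an isolated vertex the total mass would be \<open>\<alpha>\<close>.\<close>

lemma sum_lazy_walk:
  assumes "x \<in> pverts G" "nbhd G x \<noteq> {}"
  shows "(\<Sum>v\<in>pverts G. lazy_walk G \<alpha> x v) = 1"
  using lazy_mean_eq[OF assms(1), of \<alpha> "\<lambda>_. 1"] assms(2) finite_nbhd[of x]
  by (simp add: lazy_mean_def)

lemma lazy_walk_nonneg:
  assumes "0 \<le> \<alpha>" "\<alpha> \<le> 1"
  shows "0 \<le> lazy_walk G \<alpha> x v"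
  using assms by (simp add: lazy_walk_def)

text \<open>Only mass \<open>1 - \<alpha>\<close> leaves \<open>x\<close>, and one step changes
  \<open>f\<close> by at most 1.\<close>

lemma lazy_mean_bounds:
  assumes "x \<in> pverts G" "nbhd G x \<noteq> {}" "\<alpha> \<le> 1"
    and lip: "\<And>v. v \<in> nbhd G x \<Longrightarrow> \<bar>f v - f x\<bar> \<le> 1"
  shows "\<bar>lazy_mean \<alpha> x f - f x\<bar> \<le> 1 - \<alpha>"
proof -
  let ?c = "real (card (nbhd G x))"
  have c: "0 < ?c"
    using assms(2) finite_nbhd[of x] by (simp add: card_gt_0_iff)
  have "lazy_mean \<alpha> x f - f x = (1 - \<alpha>) / ?c * (\<Sum>v\<in>nbhd G x. f v - f x)"
    using c by (simp add: lazy_mean_eq[OF assms(1)] sum_subtractf field_simps)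
  also have "\<bar>\<dots>\<bar> = (1 - \<alpha>) / ?c * \<bar>\<Sum>v\<in>nbhd G x. f v - f x\<bar>"
    using c assms(3) by (simp add: abs_mult)
  also have "\<dots> \<le> (1 - \<alpha>) / ?c * (\<Sum>v\<in>nbhd G x. 1)"
    using c assms(3) by (intro mult_left_mono order_trans[OF sum_abs] sum_mono lip) auto
  finally show ?thesis
    using c by simp
qed

section \<open>Couplings and transportation distance\<close>

lemma couplings_nonempty:
  assumes "\<And>v. 0 \<le> m1 v" "\<And>v. 0 \<le> m2 v"
    and "(\<Sum>v\<in>pverts G. m1 v) = 1" "(\<Sum>v\<in>pverts G. m2 v) = 1"
  shows "couplings G m1 m2 \<noteq> {}"
proof -
  have le_1: "m v \<le> 1" if "\<And>v. 0 \<le> m v" "(\<Sum>v\<in>pverts G. m v) = 1" "v \<in> pverts G"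
    for m :: "'a \<Rightarrow> real" and v
    using that member_le_sum[of v "pverts G" m] finite_verts by simp
  \<comment> \<open>The product measure. A coupling must be exhibited because a real infimum over
    the empty set carries no information.\<close>
  have "(\<lambda>u v. m1 u * m2 v) \<in> couplings G m1 m2"
    using assms le_1[of m1] le_1[of m2]
    by (auto simp: couplings_def mult_le_one simp flip: sum_distrib_left sum_distrib_right)
  then show ?thesis by blast
qed

lemma transport_dist_le:
  assumes "A \<in> couplings G m1 m2"
  shows "transport_dist G m1 m2 \<le> (\<Sum>u\<in>pverts G. \<Sum>v\<in>pverts G. A u v * graph_dist G u v)"
  unfolding transport_dist_def
  by (rule cINF_lower[OF bdd_belowI2[of _ 0] assms])
    (auto simp: couplings_def intro!: sum_nonneg mult_nonneg_nonneg graph_dist_nonneg)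

text \<open>By the marginal conditions, the difference of the means is the sum of
  \<open>f v - f u\<close> weighted by any coupling; the Lipschitz bound compares this with the cost
  of that coupling.\<close>

lemma transport_dist_ge:
  assumes ne: "couplings G m1 m2 \<noteq> {}"
    and lip: "\<And>u v. u \<in> pverts G \<Longrightarrow> v \<in> pverts G \<Longrightarrow> f v - f u \<le> graph_dist G u v"
  shows "(\<Sum>v\<in>pverts G. m2 v * f v) - (\<Sum>u\<in>pverts G. m1 u * f u) \<le> transport_dist G m1 m2"
  unfolding transport_dist_def
proof (rule cINF_greatest[OF ne])
  fix A assume A: "A \<in> couplings G m1 m2"
  have "(\<Sum>v\<in>pverts G. m2 v * f v) = (\<Sum>v\<in>pverts G. \<Sum>u\<in>pverts G. A u v * f v)"
    using A by (intro sum.cong) (auto simp: couplings_def simp flip: sum_distrib_right)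
  also have "\<dots> = (\<Sum>u\<in>pverts G. \<Sum>v\<in>pverts G. A u v * f v)"
    by (rule sum.swap)
  moreover have "(\<Sum>u\<in>pverts G. m1 u * f u) = (\<Sum>u\<in>pverts G. \<Sum>v\<in>pverts G. A u v * f u)"
    using A by (intro sum.cong) (auto simp: couplings_def simp flip: sum_distrib_right)
  ultimately have "(\<Sum>v\<in>pverts G. m2 v * f v) - (\<Sum>u\<in>pverts G. m1 u * f u)
      = (\<Sum>u\<in>pverts G. \<Sum>v\<in>pverts G. A u v * (f v - f u))"
    by (simp add: right_diff_distrib sum_subtractf)
  also have "\<dots> \<le> (\<Sum>u\<in>pverts G. \<Sum>v\<in>pverts G. A u v * graph_dist G u v)"
    using A by (intro sum_mono mult_left_mono lip) (auto simp: couplings_def)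
  finally show "(\<Sum>v\<in>pverts G. m2 v * f v) - (\<Sum>u\<in>pverts G. m1 u * f u)
      \<le> (\<Sum>u\<in>pverts G. \<Sum>v\<in>pverts G. A u v * graph_dist G u v)" .
qed

lemma lazy_couplings_nonempty:
  assumes "(x, y) \<in> parcs G" "0 \<le> \<alpha>" "\<alpha> < 1"
  shows "couplings G (lazy_walk G \<alpha> x) (lazy_walk G \<alpha> y) \<noteq> {}"
proof -
  have "x \<in> pverts G" "y \<in> pverts G" "nbhd G x \<noteq> {}" "nbhd G y \<noteq> {}"
    using assms(1) wellformed' arcs_symmetric[OF assms(1)] by (auto simp: nbhd_def)
  with assms(2,3) show ?thesis
    by (intro couplings_nonempty lazy_walk_nonneg sum_lazy_walk) auto
qed

section \<open>Curvature along a geodesic\<close>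

lemma lazy_mean_diff_le_ricci:
  assumes "(x, y) \<in> parcs G" "0 \<le> \<alpha>" "\<alpha> < 1" "z \<in> pverts G"
  shows "lazy_mean \<alpha> y (graph_dist G z) - lazy_mean \<alpha> x (graph_dist G z) \<le> 1 - ricci G \<alpha> x y"
proof -
  have "lazy_mean \<alpha> y (graph_dist G z) - lazy_mean \<alpha> x (graph_dist G z)
    \<le> transport_dist G (lazy_walk G \<alpha> x) (lazy_walk G \<alpha> y)"
    unfolding lazy_mean_def
    using transport_dist_ge[OF lazy_couplings_nonempty[OF assms(1-3)], of "graph_dist G z"]
      graph_dist_triangle[OF assms(4)] by (simp add: algebra_simps)
  then show ?thesis
    by (simp add: ricci_def graph_dist_arc[OF assms(1)])
qed

lemma sum_ricci_geodesic_le: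
  assumes "u \<in> pverts G" "x 0 = u" "0 \<le> \<alpha>" "\<alpha> < 1"
    and arcs: "\<And>i. i < n \<Longrightarrow> (x i, x (Suc i)) \<in> parcs G"
    and dist: "graph_dist G u (x n) = real n"
  shows "(\<Sum>i<n. ricci G \<alpha> (x i) (x (Suc i))) \<le> 2 * (1 - \<alpha>)"
proof (cases n)
  case 0
  with assms show ?thesis by simp
next
  case (Suc m)
  let ?f = "graph_dist G u"
  \<comment> \<open>For positive \<open>n\<close> both ends have a neighbour, as
    \<open>lazy_mean_bounds\<close> requires.\<close>
  have endpoints: "(x 0, x (Suc 0)) \<in> parcs G" "(x m, x n) \<in> parcs G"
    using arcs[of 0] arcs[of m] Suc by auto
  have mean: "\<bar>lazy_mean \<alpha> w ?f - ?f w\<bar> \<le> 1 - \<alpha>" if w: "(v, w) \<in> parcs G" for v w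
  proof (rule lazy_mean_bounds)
    show wV: "w \<in> pverts G" and "nbhd G w \<noteq> {}"
      using w wellformed' by (auto simp: nbhd_def)
    fix z assume "z \<in> nbhd G w"
    then have z: "(z, w) \<in> parcs G" "(w, z) \<in> parcs G"
      using arcs_symmetric by (auto simp: nbhd_def)
    then have "z \<in> pverts G"
      using wellformed' by auto
    with graph_dist_triangle[OF assms(1) wV, of z] graph_dist_triangle[OF assms(1) _ wV, of z]
    show "\<bar>?f z - ?f w\<bar> \<le> 1"
      using z by (simp add: graph_dist_arc)
  qed (use assms in auto)
  \<comment> \<open>Each end contributes an error of at most \<open>1 - \<alpha>\<close>; this is
    the origin of the constant 2.\<close>
  have "real n - 2 * (1 - \<alpha>) \<le> lazy_mean \<alpha> (x n) ?f - lazy_mean \<alpha> (x 0) ?f"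
    using mean[OF endpoints(2)] mean[OF arcs_symmetric[OF endpoints(1)]] dist
      graph_dist_self[OF assms(1)] assms(2) by (simp add: abs_le_iff)
  also have "\<dots> = (\<Sum>i<n. lazy_mean \<alpha> (x (Suc i)) ?f - lazy_mean \<alpha> (x i) ?f)"
    by (rule sum_lessThan_telescope[symmetric])
  also have "\<dots> \<le> (\<Sum>i<n. 1 - ricci G \<alpha> (x i) (x (Suc i)))"
    using arcs assms by (intro sum_mono lazy_mean_diff_le_ricci) auto
  finally show ?thesis
    by (simp add: sum_subtractf)
qed

section \<open>Existence of the Lin--Lu--Yau limit\<close>

text \<open>
  Mixing a coupling of the \<open>a\<close>-lazy walks with the unit mass at \<open>(x, y)\<close> gives a coupling of the
  \<open>b\<close>-lazy walks.
\<close>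

lemma ricci_div_mono:
  assumes arc: "(x, y) \<in> parcs G" and ab: "0 \<le> a" "a \<le> b" "b < 1"
  shows "ricci G a x y / (1 - a) \<le> ricci G b x y / (1 - b)"
proof -
  \<comment> \<open>Chosen so that the \<open>b\<close>-lazy walk is \<open>t\<close> times the
    \<open>a\<close>-lazy walk plus mass \<open>1 - t\<close> at the starting vertex.\<close>
  define t where "t = (1 - b) / (1 - a)"
  have t: "0 < t" "t \<le> 1" and tb: "1 - b = t * (1 - a)"
    using ab by (auto simp: t_def field_simps)
  then have b: "b = t * a + (1 - t)"
    unfolding right_diff_distrib by linarith
  have lazy: "lazy_walk G b z v = t * lazy_walk G a z v + (if v = z then 1 - t else 0)" for z v
    by (simp add: lazy_walk_def tb) (simp add: b)
  have xy: "x \<in> pverts G" "y \<in> pverts G"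
    using arc wellformed' by auto
  let ?W = "\<lambda>c. transport_dist G (lazy_walk G c x) (lazy_walk G c y)"
  \<comment> \<open>This is \<open>?W b \<le> t * ?W a + (1 - t)\<close>, solved for
    \<open>?W a\<close> so that \<open>cINF_greatest\<close> applies to that infimum.\<close>
  have "(?W b - (1 - t)) / t \<le> ?W a"
    unfolding transport_dist_def[of _ "lazy_walk G a x"]
  proof (rule cINF_greatest)
    show "couplings G (lazy_walk G a x) (lazy_walk G a y) \<noteq> {}"
      using lazy_couplings_nonempty[OF arc] ab by auto
    fix A assume A: "A \<in> couplings G (lazy_walk G a x) (lazy_walk G a y)"
    let ?cost = "\<lambda>A. \<Sum>u\<in>pverts G. \<Sum>v\<in>pverts G. A u v * graph_dist G u v"
    define P :: "'a \<Rightarrow> 'a \<Rightarrow> real"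
      where "P u v = (if v = y then if u = x then 1 - t else 0 else 0)" for u v
    define B where "B u v = t * A u v + P u v" for u v
    have P1: "(\<Sum>v\<in>pverts G. P u v) = (if u = x then 1 - t else 0)" for u
      using xy finite_verts by (simp add: P_def sum.delta)
    have P2: "(\<Sum>u\<in>pverts G. P u v) = (if v = y then 1 - t else 0)" for v
      using xy finite_verts by (simp add: P_def sum.delta)
    have "0 \<le> B u v \<and> B u v \<le> 1" if "u \<in> pverts G" "v \<in> pverts G" for u v
    proof -
      have "0 \<le> A u v" "A u v \<le> 1"
        using A that by (auto simp: couplings_def)
      then have "0 \<le> t * A u v" "t * A u v \<le> t"
        using t by (auto simp: mult_left_le)
      moreover have "0 \<le> P u v" "P u v \<le> 1 - t"
        using t by (auto simp: P_def)
      ultimately show ?thesis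
        unfolding B_def by linarith
    qed
    then have "B \<in> couplings G (lazy_walk G b x) (lazy_walk G b y)"
      using A by (auto simp: couplings_def B_def sum.distrib P1 P2 lazy simp flip: sum_distrib_left)
    then have "?W b \<le> ?cost B"
      by (rule transport_dist_le)
    also have "?cost P = 1 - t"
    proof -
      have "P u v * graph_dist G u v = P u v" for u v
        using graph_dist_arc[OF arc] by (simp add: P_def)
      then show ?thesis
        using xy finite_verts by (simp only: P1) (simp add: sum.delta)
    qed
    then have "?cost B = t * ?cost A + (1 - t)"
      by (simp add: B_def distrib_right sum.distrib sum_distrib_left mult.assoc)
    finally show "(?W b - (1 - t)) / t \<le> ?cost A"
      using t by (simp add: field_simps)
  qed
  \<comment> \<open>On an arc the curvature is 1 minus the transportation distance, so the constants
    cancel.\<close>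
  then have "t * ricci G a x y \<le> ricci G b x y"
    using t by (simp add: ricci_def graph_dist_arc[OF arc] field_simps)
  then have "t * ricci G a x y / (t * (1 - a)) \<le> ricci G b x y / (1 - b)"
    using ab unfolding tb[symmetric] by (intro divide_right_mono) auto
  then show ?thesis
    using t by simp
qed

text \<open>The one-edge case of \<open>sum_ricci_geodesic_le\<close>; it supplies the bound for
  monotone convergence.\<close>

lemma ricci_div_le_2:
  assumes arc: "(x, y) \<in> parcs G" and \<alpha>: "0 \<le> \<alpha>" "\<alpha> < 1"
  shows "ricci G \<alpha> x y / (1 - \<alpha>) \<le> 2"
  using sum_ricci_geodesic_le[of x "\<lambda>i. if i = 0 then x else y" \<alpha> 1] arc \<alpha>
    graph_dist_arc[OF arc] wellformed'[of x y]
  by (simp add: field_simps)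

text \<open>\<open>Lim\<close> is informative only once some limit is known to exist; here it is a
  supremum.\<close>

lemma ricci_LLY_tendsto:
  assumes arc: "(x, y) \<in> parcs G"
  shows "((\<lambda>\<alpha>. ricci G \<alpha> x y / (1 - \<alpha>)) \<longlongrightarrow> ricci_LLY G x y) (at_left 1)"
proof -
  let ?h = "\<lambda>\<alpha>. ricci G \<alpha> x y / (1 - \<alpha>)"
  have "(?h \<longlongrightarrow> Sup (?h ` ({..<1} \<inter> {0..}))) (at 1 within ({..<1} \<inter> {0..}))"
    by (rule Lim_left_bound[where K = 2]) (auto intro: ricci_div_mono[OF arc] ricci_div_le_2[OF arc])
  \<comment> \<open>Monotonicity is available for nonnegative laziness only, a restriction that does
    not affect the filter at 1.\<close>
  moreover have "at 1 within ({..<1} \<inter> {0..}) = at_left (1::real)"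
    by (rule at_within_nhd[of _ "{0<..}"]) auto
  ultimately show ?thesis
    unfolding ricci_LLY_def by (metis tendsto_Lim trivial_limit_at_left_real)
qed

text \<open>Divided by \<open>1 - \<alpha>\<close>, the lazy bound is uniform in
  \<open>\<alpha>\<close> and passes to the limit.\<close>

lemma sum_ricci_LLY_geodesic_le:
  assumes "u \<in> pverts G" "x 0 = u"
    and arcs: "\<And>i. i < n \<Longrightarrow> (x i, x (Suc i)) \<in> parcs G"
    and dist: "graph_dist G u (x n) = real n"
  shows "(\<Sum>i<n. ricci_LLY G (x i) (x (Suc i))) \<le> 2"
proof (rule tendsto_upperbound)
  show "((\<lambda>\<alpha>. \<Sum>i<n. ricci G \<alpha> (x i) (x (Suc i)) / (1 - \<alpha>))
      \<longlongrightarrow> (\<Sum>i<n. ricci_LLY G (x i) (x (Suc i)))) (at_left 1)"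
    using arcs by (intro tendsto_sum ricci_LLY_tendsto) auto
  have "(\<Sum>i<n. ricci G \<alpha> (x i) (x (Suc i)) / (1 - \<alpha>)) \<le> 2" if "\<alpha> \<in> {0<..<1}" for \<alpha>
    using that sum_ricci_geodesic_le[OF assms(1,2) _ _ arcs dist, of \<alpha>]
    by (simp add: field_simps flip: sum_divide_distrib)
  then show "\<forall>\<^sub>F \<alpha> in at_left 1. (\<Sum>i<n. ricci G \<alpha> (x i) (x (Suc i)) / (1 - \<alpha>)) \<le> 2"
    using eventually_at_left_real[of 0 "1::real"] by (auto elim: eventually_mono)
qed simp

section \<open>From curvature sums to the diameter\<close>

text \<open>Stated for an abstract curvature \<open>c\<close> to serve both versions. The inequality
  \<open>k \<le> c + max 0 (k - c)\<close> is summed along a geodesic.\<close>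

lemma graph_dist_le_of_geodesic_sum:
  assumes "u \<in> pverts G" "v \<in> pverts G" "0 < k"
    and sym: "\<And>a b. c a b = c b a"
    and bound: "\<And>x n. x 0 = u \<Longrightarrow> (\<And>i. i < n \<Longrightarrow> (x i, x (Suc i)) \<in> parcs G)
      \<Longrightarrow> graph_dist G u (x n) = real n \<Longrightarrow> (\<Sum>i<n. c (x i) (x (Suc i))) \<le> C"
  shows "k * graph_dist G u v \<le> C + edge_sum G (\<lambda>a b. max 0 (k - c a b))"
proof -
  obtain p where "awalk u p v" "graph_dist G u v = real (length p)"
    using assms(1,2) by (auto elim: graph_dist_awalk)
  then obtain n where n: "graph_dist G u v = real n"
    by blast
  obtain x where x: "x 0 = u" "x n = v" "\<And>i. i < n \<Longrightarrow> (x i, x (Suc i)) \<in> parcs G"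
      "\<And>i. i \<le> n \<Longrightarrow> graph_dist G u (x i) = real i"
    using geodesic[OF assms(1,2) n] by blast
  have "inj_on x {..n}"
    by (rule inj_onI) (metis x(4) atMost_iff of_nat_eq_iff)
  have "k * real n = (\<Sum>i<n. k)"
    by simp
  also have "\<dots> \<le> (\<Sum>i<n. c (x i) (x (Suc i)) + max 0 (k - c (x i) (x (Suc i))))"
    by (intro sum_mono) simp
  also have "\<dots> \<le> C + edge_sum G (\<lambda>a b. max 0 (k - c a b))"
    unfolding sum.distrib using x \<open>inj_on x {..n}\<close> sym
    by (intro add_mono bound geodesic_sum_le_edge_sum) auto
  finally show ?thesis
    by (simp add: n)
qed

text \<open>Distances are lengths of walks, hence integers, so rounding \<open>r\<close> down loses
  nothing.\<close>

lemma graph_diam_le_floor: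
  assumes "\<And>u v. u \<in> pverts G \<Longrightarrow> v \<in> pverts G \<Longrightarrow> graph_dist G u v \<le> r"
  shows "graph_diam G \<le> real_of_int \<lfloor>r\<rfloor>"
proof -
  have "graph_dist G u v \<le> real_of_int \<lfloor>r\<rfloor>" if uv: "u \<in> pverts G" "v \<in> pverts G" for u v
  proof -
    obtain p where p: "awalk u p v" "graph_dist G u v = real (length p)"
      using uv by (auto elim: graph_dist_awalk)
    from p(2) assms[OF uv] have "int (length p) \<le> \<lfloor>r\<rfloor>"
      by (simp add: le_floor_iff)
    with p(2) show ?thesis
      by (metis of_int_le_iff of_int_of_nat_eq)
  qed
  moreover have "{graph_dist G u v | u v. u \<in> pverts G \<and> v \<in> pverts G} \<noteq> {}"
    using pverts_nonempty by blast
  ultimately show ?thesis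
    unfolding graph_diam_def using finite_verts
    by (subst Max_le_iff) (auto intro: finite_image_set2)
qed

end

theorem theorem1p1:
  fixes G :: "'a pair_pre_digraph" and \<kappa>0 \<alpha> :: real
  assumes "pair_graph G"
    and "Digraph_Component.connected (with_proj G)"
    and "\<kappa>0 > 0"
    and "0 \<le> \<alpha>" and "\<alpha> < 1"
  shows "graph_diam G \<le> real_of_int \<lfloor>(2 + integral_curv_lazy G \<alpha> \<kappa>0 / (1 - \<alpha>)) / \<kappa>0\<rfloor>
    \<and> graph_diam G \<le> real_of_int \<lfloor>(2 + integral_curv_LLY G \<kappa>0) / \<kappa>0\<rfloor>"
proof -
  interpret pair_connected_graph G
    using assms(1,2) by (simp add: pair_connected_graph_def pair_connected_graph_axioms_def)
  have ricci_sym: "ricci G a x y = ricci G a y x" for a x y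
    unfolding ricci_def
    using graph_dist_commute[OF assms(1)] transport_dist_commute[OF assms(1)] by metis
  show ?thesis
  proof (intro conjI graph_diam_le_floor)
    fix u v assume uv: "u \<in> pverts G" "v \<in> pverts G"
    \<comment> \<open>Here \<open>k\<close> is \<open>(1 - \<alpha>) * \<kappa>0\<close> and
      \<open>C\<close> is \<open>2 * (1 - \<alpha>)\<close>; division by \<open>k\<close> gives the
      claim.\<close>
    have "(1 - \<alpha>) * \<kappa>0 * graph_dist G u v \<le> 2 * (1 - \<alpha>) + integral_curv_lazy G \<alpha> \<kappa>0"
      unfolding integral_curv_lazy_def rho_lazy_def
      using assms(3-5) by (intro graph_dist_le_of_geodesic_sum uv ricci_sym
          sum_ricci_geodesic_le[where u = u]) auto
    with assms show "graph_dist G u v \<le> (2 + integral_curv_lazy G \<alpha> \<kappa>0 / (1 - \<alpha>)) / \<kappa>0"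
      by (simp add: field_simps)
    have "\<kappa>0 * graph_dist G u v \<le> 2 + integral_curv_LLY G \<kappa>0"
      unfolding integral_curv_LLY_def rho_LLY_def
      using assms(3) uv
      by (intro graph_dist_le_of_geodesic_sum sum_ricci_LLY_geodesic_le[where u = u])
        (auto simp: ricci_LLY_def ricci_sym)
    with assms show "graph_dist G u v \<le> (2 + integral_curv_LLY G \<kappa>0) / \<kappa>0"
      by (simp add: field_simps)
  qed
qed

end
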